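(* Let $v = p_1^{e_1}\cdots p_t^{e_t}\ge 3$ be an odd integer in prime factorization ($p_1,\dots,p_t$ distinct primes, $e_i\ge 1$), and for each $i$ fix a primitive root $\eta_i$ modulo $p_i^{e_i}$. Then for every even divisor $k$ of $\gcd(p_1-1,\dots,p_t-1)$ there exist at least $\varphi(k)^t$ $(v,k,1)$-RMDs based on $\mathbb{Z}_v$, each of which is of the form $(\mathbb{Z}_v,\mathcal{B}(a))$ for some $[a]\in\mathbb{Z}_v^*$ with $$a=\sum_{i=1}^t \frac{v}{p_i^{e_i}}\,a_i b_i,$$ and admits $\mathbb{Z}_v\rtimes\langle[a]\rangle$ as a group of automorphisms, where $b_i$ is the inverse of $v/p_i^{e_i}$ modulo $p_i^{e_i}$, and $a_i$ satisfies $a_i\equiv \eta_i^{m_i\varphi(p_i^{e_i})/k} \pmod{p_i^{e_i}}$ for an integer $m_i$ coprime to $k$.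
   Context: $\varphi$ is Euler's totient function. $\mathbb{Z}_v$ is the additive group of integers modulo $v$, $[x]$ denotes the residue class of $x$, and $\mathbb{Z}_v^*$ is the multiplicative group of units modulo $v$, acting on $\mathbb{Z}_v$ by multiplication; $\langle[a]\rangle$ is the subgroup of $\mathbb{Z}_v^*$ generated by $[a]$, and $\mathbb{Z}_v\rtimes\langle[a]\rangle$ is the corresponding semidirect product. Mendelsohn designs. For integers $v\ge k\ge 2$, a $(v,k,1)$-Mendelsohn design, or $(v,k,1)$-MD, is a set $X$ of $v$ points together with a collection $\mathcal{B}$ of cyclically ordered $k$-subsets of $X$ (blocks) such that every ordered pair of distinct points is consecutive in exactly one block (in a block $(a_1,\dots,a_k)$ the consecutive ordered pairs are $(a_i,a_{i+1})$, subscripts modulo $k$). It is resolvable (a $(v,k,1)$-RMD) if either $v\equiv 0 \pmod k$ and the blocks can be partitioned into $v-1$ parts each consisting of $v/k$ pairwise disjoint blocks, or $v\equiv 1\pmod k$ and the blocks can be partitioned into $v$ parts each consisting of $(v-1)/k$ pairwise disjoint blocks. An MD $(X,\mathcal{B})$ admits a group $G$ as a group of automorphisms if $G$ acts (not necessarily faithfully) on $X$ and preserves the set $\mathcal{B}$ of cyclically ordered blocks. It is based on $G$ if $X$ can be identified with $G$ so that the MD admits the left regular representation of $G$ (here, translations of $\mathbb{Z}_v$) as a group of automorphisms. Designs are counted as distinct pairs $(\mathbb{Z}_v,\mathcal{B})$, not up to isomorphism. Construction of $\mathcal{B}(a)$. For $[a]\in\mathbb{Z}_v^*$ of order $k$,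 $\mathcal{B}(a)$ is the set of all cyclically ordered blocks $([x+y],[x+ay],[x+a^2y],\dots,[x+a^{k-1}y])$ with $[x]\in\mathbb{Z}_v$ and $[y]\in\mathbb{Z}_v\setminus\{[0]\}$, repeated blocks being counted once. *)

theory Defs
  imports "HOL-Number_Theory.Number_Theory" "HOL-Algebra.Group_Action" "HOL-Library.Disjoint_Sets"
begin

section \<open>Cyclically ordered blocks\<close>

text \<open>
  A cyclically ordered set \<open>(a\<^sub>1, \<dots>, a\<^sub>k)\<close> is the set of all rotations of the list
  \<open>[a\<^sub>1, \<dots>, a\<^sub>k]\<close>, so that \<open>cyc xs = cyc ys\<close> iff \<open>ys\<close> is a rotation of \<open>xs\<close>.
\<close>

type_synonym 'a cblock = "'a list set"

definition cyc :: "'a list \<Rightarrow> 'a cblock" where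
  "cyc xs = {rotate n xs | n. True}"

definition cyclic_subsets :: "nat \<Rightarrow> 'a set \<Rightarrow> 'a cblock set" where
  "cyclic_subsets k X = {cyc xs | xs. length xs = k \<and> distinct xs \<and> set xs \<subseteq> X}"

definition block_points :: "'a cblock \<Rightarrow> 'a set" where
  "block_points b = (\<Union>xs\<in>b. set xs)"

definition consecutive :: "'a cblock \<Rightarrow> 'a \<Rightarrow> 'a \<Rightarrow> bool" where
  "consecutive b x y \<longleftrightarrow>
     (\<exists>xs\<in>b. \<exists>i<length xs. x = xs ! i \<and> y = xs ! (Suc i mod length xs))"


section \<open>Mendelsohn designs\<close>

text \<open>
  A set of blocks suffices: as \<open>k \<ge> 2\<close>, every block contains a consecutive pair, so a block
  cannot be repeated.
\<close>

definition mendelsohn_design :: "nat \<Rightarrow> nat \<Rightarrow> 'a set \<Rightarrow> 'a cblock set \<Rightarrow> bool" where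
  "mendelsohn_design v k X \<B> \<longleftrightarrow>
     2 \<le> k \<and> k \<le> v \<and> finite X \<and> card X = v \<and>
     \<B> \<subseteq> cyclic_subsets k X \<and>
     (\<forall>x\<in>X. \<forall>y\<in>X. x \<noteq> y \<longrightarrow> (\<exists>!b. b \<in> \<B> \<and> consecutive b x y))"

definition partitions_into_classes :: "'a cblock set \<Rightarrow> nat \<Rightarrow> nat \<Rightarrow> bool" where
  "partitions_into_classes \<B> n s \<longleftrightarrow>
     (\<exists>\<P>. partition_on \<B> \<P> \<and> card \<P> = n \<and>
          (\<forall>P\<in>\<P>. card P = s \<and> disjoint_family_on block_points P))"

definition resolvable :: "nat \<Rightarrow> nat \<Rightarrow> 'a cblock set \<Rightarrow> bool" where
  "resolvable v k \<B> \<longleftrightarrow>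
     [v = 0] (mod k) \<and> partitions_into_classes \<B> (v - 1) (v div k) \<or>
     [v = 1] (mod k) \<and> partitions_into_classes \<B> v ((v - 1) div k)"

definition resolvable_mendelsohn_design ::
    "nat \<Rightarrow> nat \<Rightarrow> 'a set \<Rightarrow> 'a cblock set \<Rightarrow> bool" where
  "resolvable_mendelsohn_design v k X \<B> \<longleftrightarrow> mendelsohn_design v k X \<B> \<and> resolvable v k \<B>"


section \<open>Groups of automorphisms\<close>

text \<open>
  The action \<open>\<phi>\<close> is a parameter, since every group acts trivially on every design.
\<close>

definition acts_by_automorphisms ::
    "('g, 'm) monoid_scheme \<Rightarrow> 'a set \<Rightarrow> 'a cblock set \<Rightarrow> ('g \<Rightarrow> 'a \<Rightarrow> 'a) \<Rightarrow> bool" where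
  "acts_by_automorphisms G X \<B> \<phi> \<longleftrightarrow>
     group_action G X \<phi> \<and> (\<forall>g\<in>carrier G. (\<lambda>b. map (\<phi> g) ` b) ` \<B> = \<B>)"

text \<open>
  The bijection \<open>f\<close> identifies \<open>G\<close> with the point set.
\<close>

definition based_on :: "('g, 'm) monoid_scheme \<Rightarrow> 'a set \<Rightarrow> 'a cblock set \<Rightarrow> bool" where
  "based_on G X \<B> \<longleftrightarrow>
     (\<exists>f. bij_betw f (carrier G) X \<and>
          acts_by_automorphisms G X \<B>
            (\<lambda>g. \<lambda>x\<in>X. f (g \<otimes>\<^bsub>G\<^esub> inv_into (carrier G) f x)))"

definition semidirect_product ::
    "('g, 'm) monoid_scheme \<Rightarrow> ('h, 'n) monoid_scheme \<Rightarrow> ('h \<Rightarrow> 'g \<Rightarrow> 'g) \<Rightarrow> ('g \<times> 'h) monoid" where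
  "semidirect_product G H \<theta> =
     \<lparr>carrier = carrier G \<times> carrier H,
      monoid.mult = (\<lambda>(x, h) (y, l). (x \<otimes>\<^bsub>G\<^esub> \<theta> h y, h \<otimes>\<^bsub>H\<^esub> l)),
      one = (\<one>\<^bsub>G\<^esub>, \<one>\<^bsub>H\<^esub>)\<rparr>"


section \<open>The designs on the integers modulo v\<close>

abbreviation Z_mod :: "nat \<Rightarrow> int ring" where
  "Z_mod v \<equiv> residue_ring (int v)"

abbreviation unit_subgroup :: "nat \<Rightarrow> int \<Rightarrow> int monoid" where
  "unit_subgroup v a \<equiv>
     (units_of (Z_mod v)) \<lparr>carrier := generate (units_of (Z_mod v)) {a}\<rparr>"

definition affine_group :: "nat \<Rightarrow> int \<Rightarrow> (int \<times> int) monoid" where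
  "affine_group v a =
     semidirect_product (add_monoid (Z_mod v)) (unit_subgroup v a) (\<lambda>h y. h \<otimes>\<^bsub>Z_mod v\<^esub> y)"

definition affine_action :: "nat \<Rightarrow> int \<times> int \<Rightarrow> int \<Rightarrow> int" where
  "affine_action v = (\<lambda>(x, h). \<lambda>z\<in>carrier (Z_mod v). x \<oplus>\<^bsub>Z_mod v\<^esub> h \<otimes>\<^bsub>Z_mod v\<^esub> z)"

text \<open>
  In the following, \<open>a\<close> is a unit, given by its representative in \<open>{0..<v}\<close>; the length of the
  blocks is its order in the group of units.
\<close>

definition orbit_blocks :: "nat \<Rightarrow> int \<Rightarrow> int cblock set" where
  "orbit_blocks v a =
     {cyc (map (\<lambda>i::nat. x \<oplus>\<^bsub>Z_mod v\<^esub> (a [^]\<^bsub>Z_mod v\<^esub> i) \<otimes>\<^bsub>Z_mod v\<^esub> y)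
               [0..<group.ord (units_of (Z_mod v)) a]) | x y.
        x \<in> carrier (Z_mod v) \<and> y \<in> carrier (Z_mod v) - {\<zero>\<^bsub>Z_mod v\<^esub>}}"

end

theory Submission
  imports Defs
begin

text \<open>
  Let \<open>a\<close> be a unit modulo \<open>v\<close> of order \<open>k \<ge> 2\<close> such that \<open>a ^ i - 1\<close> is a unit for \<open>0 < i < k\<close>.
  Then \<open>\<langle>a\<rangle>\<close> acts freely on the nonzero residues, and the blocks of \<open>a\<close> are the translates of its
  orbits there, each orbit cyclically ordered by multiplication by \<open>a\<close>.  If \<open>(u, w)\<close> are consecutive
  in the block \<open>(x + y, x + a y, \<dots>)\<close> and \<open>y\<close> is chosen in its orbit with \<open>u = x + y\<close>, then
  \<open>w - u = (a - 1) y\<close>.  Since \<open>a - 1\<close> is invertible, an ordered pair of distinct points determines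
  \<open>y\<close> and \<open>x\<close>, so it is consecutive in exactly one block
  (\<open>consecutive_determines_block\<close>, \<open>block_through_pair\<close>).  For fixed \<open>x\<close> the blocks partition the
  points other than \<open>x\<close>; letting \<open>x\<close> vary gives the \<open>v\<close> resolution classes.  An affine map sends
  blocks to blocks (\<open>affine_image_blocks\<close>), and translations are the affine maps of multiplier one.

  Such units come from the Chinese remainder theorem.  Modulo \<open>p ^ e\<close> take an element \<open>g\<close> of order
  \<open>k\<close>, namely a power of the primitive root.  As \<open>k\<close> divides \<open>p - 1\<close> it is coprime to \<open>p\<close>, and this
  forces \<open>g\<close> to have order \<open>k\<close> already modulo \<open>p\<close> (\<open>cong_1_mod_power\<close>).  So \<open>p\<close> does not divide
  \<open>g ^ i - 1\<close> for \<open>0 < i < k\<close>, and the condition on \<open>a\<close> holds modulo \<open>v\<close> once it holds modulo each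
  \<open>p ^ e\<close>.  There are \<open>\<phi>(k)\<close> choices of \<open>g\<close> for each of the \<open>t\<close> primes.  Different choices give
  different designs, because three consecutive points \<open>u, w, z\<close> of a block satisfy
  \<open>z - w = a (w - u)\<close> (\<open>blocks_determine_unit\<close>).
\<close>

section \<open>Cyclic blocks as periodic sequences\<close>

lemma cyc_rotate: "cyc (rotate n xs) = cyc xs"
proof
  show "cyc (rotate n xs) \<subseteq> cyc xs"
    by (auto simp: cyc_def rotate_rotate)
  have "rotate m xs \<in> cyc (rotate n xs)" for m
  proof (cases "xs = []")
    case True
    then show ?thesis by (auto simp: cyc_def)
  next
    case False
    \<comment> \<open>Rotating by \<open>n\<close> another \<open>length xs - 1\<close> times undoes the rotation by \<open>n\<close>.\<close>
    define l where "l = m + (length xs - 1) * n"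
    have "l + n = m + length xs * n"
      using False by (cases "length xs") (auto simp: l_def algebra_simps)
    then have "(l + n) mod length xs = m mod length xs" by simp
    then have "rotate m xs = rotate l (rotate n xs)"
      by (metis rotate_conv_mod rotate_rotate)
    then show ?thesis by (auto simp: cyc_def)
  qed
  then show "cyc xs \<subseteq> cyc (rotate n xs)"
    by (auto simp: cyc_def[of xs])
qed

lemma self_in_cyc: "xs \<in> cyc xs"
  unfolding cyc_def using rotate0 by (metis (mono_tags, lifting) id_apply mem_Collect_eq)

lemma block_points_cyc: "block_points (cyc xs) = set xs"
  using self_in_cyc[of xs] by (auto simp: block_points_def cyc_def)

lemma map_image_cyc: "map f ` cyc xs = cyc (map f xs)"
  by (auto simp: cyc_def rotate_map)

lemma periodic_mod:
  fixes f :: "nat \<Rightarrow> 'a"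
  assumes "\<And>i. f (i + k) = f i"
  shows "f (n + m mod k) = f (n + m)"
proof -
  have "f (i + j * k) = f i" for i j
  proof (induction j)
    case (Suc j)
    then show ?case using assms[of "i + j * k"] by (simp add: ac_simps)
  qed simp
  then have "f (n + m mod k + (m div k) * k) = f (n + m mod k)" .
  then show ?thesis by (simp add: add.assoc mod_div_mult_eq)
qed

lemma rotate_periodic:
  assumes "\<And>i. f (i + k) = f i"
  shows "rotate n (map f [0..<k]) = map (\<lambda>i. f (n + i)) [0..<k]"
proof (rule nth_equalityI)
  fix i assume "i < length (rotate n (map f [0..<k]))"
  then show "rotate n (map f [0..<k]) ! i = map (\<lambda>i. f (n + i)) [0..<k] ! i"
    using periodic_mod[of f k 0 "n + i"] assms by (simp add: nth_rotate)
qed simp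

text \<open>A periodic sequence makes the wrap-around at the end of a block invisible: the successor of
  the entry at \<open>n\<close> is the entry at \<open>Suc n\<close>, for every natural number \<open>n\<close>.\<close>

lemma consecutive_cyc_periodic:
  assumes per: "\<And>i. f (i + k) = f i" and "0 < k"
  shows "consecutive (cyc (map f [0..<k])) u w \<longleftrightarrow> (\<exists>n. u = f n \<and> w = f (Suc n))"
proof
  assume "consecutive (cyc (map f [0..<k])) u w"
  then obtain n i where "i < k"
    and "u = map (\<lambda>i. f (n + i)) [0..<k] ! i"
    and "w = map (\<lambda>i. f (n + i)) [0..<k] ! (Suc i mod k)"
    unfolding consecutive_def cyc_def by (auto simp: rotate_periodic[of f, OF per])
  then have "u = f (n + i)" "w = f (n + Suc i mod k)" by auto
  then show "\<exists>n. u = f n \<and> w = f (Suc n)"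
    using periodic_mod[of f, OF per] by auto
next
  assume "\<exists>n. u = f n \<and> w = f (Suc n)"
  then obtain n where uw: "u = f n" "w = f (Suc n)" by blast
  define xs where "xs = map (\<lambda>i. f (n + i)) [0..<k]"
  have len: "length xs = k" by (simp add: xs_def)
  have nth: "xs ! j = f (n + j)" if "j < k" for j
    using that by (simp add: xs_def)
  have "xs \<in> cyc (map f [0..<k])"
    unfolding cyc_def xs_def using rotate_periodic[of f, OF per] by force
  moreover have "u = xs ! 0"
    using nth[OF \<open>0 < k\<close>] uw by simp
  moreover have "w = xs ! (Suc 0 mod length xs)"
    unfolding len nth[OF mod_less_divisor[OF \<open>0 < k\<close>]]
    using periodic_mod[of f k n "Suc 0", OF per] uw by (simp only: add_Suc_right add_0_right)
  ultimately show "consecutive (cyc (map f [0..<k])) u w"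
    unfolding consecutive_def using len \<open>0 < k\<close> by blast
qed

section \<open>The design of a unit whose powers differ from one by units\<close>

text \<open>Multiplication by \<open>a\<close> must permute the nonzero residues in cycles of length exactly \<open>k\<close>.  For
  composite \<open>v\<close> this is stronger than having order \<open>k\<close>: no \<open>a ^ i - 1\<close> may be a zero divisor.\<close>

locale semiregular_unit =
  fixes v k :: nat and a :: int
  assumes v_gt_1: "1 < v"
    and k_ge_2: "2 \<le> k"
    and pow_k: "[a ^ k = 1] (mod int v)"
    and coprime_pow_minus_1: "\<And>i. 0 < i \<Longrightarrow> i < k \<Longrightarrow> coprime (a ^ i - 1) (int v)"
begin

definition entry :: "int \<Rightarrow> int \<Rightarrow> nat \<Rightarrow> int" where
  "entry x y i = (x + a ^ i * y) mod int v"

definition block :: "int \<Rightarrow> int \<Rightarrow> int cblock" where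
  "block x y = cyc (map (entry x y) [0..<k])"

text \<open>Parameters are arbitrary integers here, since a block depends on their residues only.\<close>

definition blocks :: "int cblock set" where
  "blocks = {block x y | x y. \<not> int v dvd y}"

lemma coprime_a: "coprime a (int v)"
proof -
  have "coprime (a ^ k) (int v)"
    using cong_imp_coprime[OF cong_sym[OF pow_k]] by simp
  then show ?thesis using k_ge_2 by simp
qed

lemma coprime_pow: "coprime (a ^ i) (int v)"
  using coprime_a by simp

lemma coprime_a_minus_1: "coprime (a - 1) (int v)"
  using coprime_pow_minus_1[of 1] k_ge_2 by simp

lemma entry_eq_iff: "entry x y i = entry x' y' j \<longleftrightarrow> [x + a ^ i * y = x' + a ^ j * y'] (mod int v)"
  by (simp add: entry_def cong_def)

lemma entry_periodic: "entry x y (i + k) = entry x y i"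
proof -
  have "[x + a ^ i * a ^ k * y = x + a ^ i * 1 * y] (mod int v)"
    by (intro cong_add cong_mult cong_refl pow_k)
  then show ?thesis by (simp add: entry_eq_iff power_add)
qed

lemma entry_shift: "entry x (a ^ n * y) i = entry x y (n + i)"
  by (simp add: entry_def power_add mult_ac)

lemma entry_cong:
  assumes "[x = x'] (mod int v)" "[y = y'] (mod int v)"
  shows "entry x y = entry x' y'"
  using assms by (intro ext) (auto simp: entry_eq_iff intro!: cong_add cong_mult)

lemma block_cong:
  assumes "[x = x'] (mod int v)" "[y = y'] (mod int v)"
  shows "block x y = block x' y'"
  using entry_cong[OF assms] by (simp add: block_def)

lemma block_shift: "block x (a ^ n * y) = block x y"
proof -
  have "block x (a ^ n * y) = cyc (rotate n (map (entry x y) [0..<k]))"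
    by (simp add: block_def rotate_periodic entry_periodic entry_shift[abs_def])
  then show ?thesis by (simp add: cyc_rotate block_def)
qed

lemma inj_on_entry:
  assumes "\<not> int v dvd y"
  shows "inj_on (entry x y) {0..<k}"
proof (rule linorder_inj_onI)
  fix i j assume "i < j" and "i \<in> {0..<k}" "j \<in> {0..<k}"
  then have ij: "0 < j - i" "j - i < k" by auto
  show "entry x y i \<noteq> entry x y j"
  proof
    assume "entry x y i = entry x y j"
    then have "[a ^ j * y = a ^ i * y] (mod int v)"
      by (simp add: entry_eq_iff cong_add_lcancel cong_sym_eq)
    moreover have "a ^ j * y - a ^ i * y = a ^ i * ((a ^ (j - i) - 1) * y)"
      using \<open>i < j\<close> by (simp add: algebra_simps flip: power_add)
    ultimately have "int v dvd a ^ i * ((a ^ (j - i) - 1) * y)"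
      by (simp add: cong_iff_dvd_diff)
    then have "int v dvd y"
      using coprime_pow[of i] coprime_pow_minus_1[OF ij]
      by (simp add: coprime_dvd_mult_right_iff coprime_commute)
    with assms show False by contradiction
  qed
qed auto

lemma consecutive_block:
  "consecutive (block x y) u w \<longleftrightarrow> (\<exists>n. u = entry x y n \<and> w = entry x y (Suc n))"
  unfolding block_def using k_ge_2 by (intro consecutive_cyc_periodic entry_periodic) auto

text \<open>The entry \<open>u = x + a ^ n * y\<close> and its successor differ by \<open>a ^ n * y\<close> times the unit
  \<open>a - 1\<close>.  The pair therefore determines \<open>a ^ n * y\<close>, hence \<open>x\<close>, hence the block.\<close>

lemma consecutive_determines_block:
  assumes "consecutive (block x y) u w" "consecutive (block x' y') u w"
  shows "[x = x'] (mod int v)" "block x y = block x' y'"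
proof -
  from assms obtain n m where
    u: "[x + a ^ n * y = x' + a ^ m * y'] (mod int v)" and
    w: "[x + a ^ Suc n * y = x' + a ^ Suc m * y'] (mod int v)"
    unfolding consecutive_block by (metis entry_eq_iff)
  from cong_diff[OF w u] have "[(a - 1) * (a ^ n * y) = (a - 1) * (a ^ m * y')] (mod int v)"
    by (simp add: algebra_simps)
  then have y: "[a ^ n * y = a ^ m * y'] (mod int v)"
    using coprime_a_minus_1 by (simp add: cong_mult_lcancel)
  show x: "[x = x'] (mod int v)"
    using cong_diff[OF u y] by simp
  have "block x (a ^ n * y) = block x' (a ^ m * y')"
    by (rule block_cong[OF x y])
  then show "block x y = block x' y'" by (simp add: block_shift)
qed

text \<open>Solving \<open>(a - 1) * y = w - u\<close> and \<open>x + y = u\<close> puts \<open>u\<close> at position 0 and \<open>w\<close> at position 1.\<close>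

lemma block_through_pair:
  assumes "u \<in> {0..<int v}" "w \<in> {0..<int v}" "u \<noteq> w"
  obtains b where "b \<in> blocks" "consecutive b u w"
proof -
  obtain c where c: "[(a - 1) * c = 1] (mod int v)"
    using coprime_a_minus_1 cong_solve_coprime_int by blast
  define y where "y = c * (w - u)"
  have ay: "[(a - 1) * y = w - u] (mod int v)"
    using cong_mult[OF c cong_refl[of "w - u"]] by (simp add: y_def mult_ac)
  have "\<not> [u = w] (mod int v)"
    using assms by (auto simp: cong_def)
  then have "\<not> int v dvd w - u"
    by (simp add: cong_iff_dvd_diff dvd_diff_commute)
  then have "\<not> int v dvd y"
    using ay cong_dvd_iff dvd_mult by blast
  then have "block (u - y) y \<in> blocks" by (auto simp: blocks_def)
  moreover have "[u - y + a * y = w] (mod int v)"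
    using cong_add[OF cong_refl[of u] ay] by (simp add: algebra_simps)
  then have "u = entry (u - y) y 0" "w = entry (u - y) y (Suc 0)"
    using assms by (auto simp: entry_def cong_def)
  then have "consecutive (block (u - y) y) u w"
    unfolding consecutive_block by blast
  ultimately show thesis by (rule that)
qed

lemma entry_in_range: "entry x y i \<in> {0..<int v}"
  using v_gt_1 by (simp add: entry_def)

lemma block_points_block: "block_points (block x y) = entry x y ` {0..<k}"
  by (simp add: block_def block_points_cyc)

lemma card_block_points: "\<not> int v dvd y \<Longrightarrow> card (block_points (block x y)) = k"
  by (simp add: block_points_block card_image inj_on_entry)

text \<open>The blocks of this class are the orbits of multiplication by \<open>a\<close> on the nonzero residues,
  translated by \<open>x\<close>; so together they miss the point \<open>x\<close> and no other.\<close>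

definition parallel_class :: "int \<Rightarrow> int cblock set" where
  "parallel_class x = {block x y | y. \<not> int v dvd y}"

lemma disjoint_parallel_class: "disjoint_family_on block_points (parallel_class x)"
  unfolding disjoint_family_on_def
proof (intro ballI impI)
  fix b b' assume b: "b \<in> parallel_class x" "b' \<in> parallel_class x" "b \<noteq> b'"
  show "block_points b \<inter> block_points b' = {}"
  proof (rule ccontr)
    assume "block_points b \<inter> block_points b' \<noteq> {}"
    then obtain z where z: "z \<in> block_points b" "z \<in> block_points b'" by blast
    obtain y y' where "b = block x y" "b' = block x y'"
      using b by (auto simp: parallel_class_def)
    with z obtain i j where "entry x y i = entry x y' j"
      by (auto simp: block_points_block)
    then have "[a ^ i * y = a ^ j * y'] (mod int v)"
      by (simp add: entry_eq_iff cong_add_lcancel)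
    then have "block x (a ^ i * y) = block x (a ^ j * y')"
      by (intro block_cong) auto
    then show False
      using b \<open>b = _\<close> \<open>b' = _\<close> by (simp add: block_shift)
  qed
qed

lemma points_of_parallel_class:
  assumes "x \<in> {0..<int v}"
  shows "(\<Union>b\<in>parallel_class x. block_points b) = {0..<int v} - {x}"
proof (intro equalityI subsetI)
  fix z assume "z \<in> (\<Union>b\<in>parallel_class x. block_points b)"
  then obtain y i where y: "\<not> int v dvd y" and z: "z = entry x y i"
    by (auto simp: parallel_class_def block_points_block)
  have "z \<noteq> x"
  proof
    assume "z = x"
    then have "[x + a ^ i * y = x] (mod int v)"
      using z assms by (simp add: entry_def cong_def)
    then have "int v dvd a ^ i * y"
      by (simp add: cong_iff_dvd_diff)
    with y coprime_pow[of i] show False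
      by (simp add: coprime_dvd_mult_right_iff coprime_commute)
  qed
  then show "z \<in> {0..<int v} - {x}"
    using z entry_in_range by simp
next
  fix z assume z: "z \<in> {0..<int v} - {x}"
  then have "\<not> [z = x] (mod int v)" using assms by (auto simp: cong_def)
  then have "block x (z - x) \<in> parallel_class x"
    by (auto simp: parallel_class_def cong_iff_dvd_diff)
  moreover have "z = entry x (z - x) 0" using z by (simp add: entry_def)
  then have "z \<in> block_points (block x (z - x))"
    using k_ge_2 by (auto simp: block_points_block)
  ultimately show "z \<in> (\<Union>b\<in>parallel_class x. block_points b)" by blast
qed

lemma finite_parallel_class: "finite (parallel_class x)"
proof -
  have "parallel_class x \<subseteq> block x ` {0..<int v}"
  proof
    fix b assume "b \<in> parallel_class x"
    then obtain y where "b = block x y" by (auto simp: parallel_class_def)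
    then have "b = block x (y mod int v)"
      using block_cong[of x x y "y mod int v"] by (simp add: cong_def)
    then show "b \<in> block x ` {0..<int v}" using v_gt_1 by auto
  qed
  then show ?thesis by (rule finite_subset) simp
qed

lemma card_parallel_class:
  assumes "x \<in> {0..<int v}"
  shows "k * card (parallel_class x) = v - 1"
proof -
  have k: "card (block_points b) = k" if "b \<in> parallel_class x" for b
    using that by (auto simp: parallel_class_def card_block_points)
  have "card (\<Union>b\<in>parallel_class x. block_points b) = (\<Sum>b\<in>parallel_class x. card (block_points b))"
  proof (rule card_UN_disjoint)
    show "finite (parallel_class x)" by (rule finite_parallel_class)
    show "\<forall>b\<in>parallel_class x. finite (block_points b)"
      using k k_ge_2 by (metis card.infinite not_numeral_le_zero)
    show "\<forall>i\<in>parallel_class x. \<forall>j\<in>parallel_class x. i \<noteq> j \<longrightarrow> block_points i \<inter> block_points j = {}"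
      using disjoint_parallel_class[of x] by (simp add: disjoint_family_on_def)
  qed
  also have "\<dots> = k * card (parallel_class x)" by (simp add: k)
  finally show ?thesis using assms by (simp add: points_of_parallel_class)
qed

lemma blocks_eq_parallel_classes: "blocks = (\<Union>x\<in>{0..<int v}. parallel_class x)"
proof
  show "blocks \<subseteq> (\<Union>x\<in>{0..<int v}. parallel_class x)"
  proof
    fix b assume "b \<in> blocks"
    then obtain x y where "b = block x y" "\<not> int v dvd y" by (auto simp: blocks_def)
    then have "b = block (x mod int v) y"
      using block_cong[of x "x mod int v" y y] by (simp add: cong_def)
    then have "b \<in> parallel_class (x mod int v)"
      using \<open>\<not> int v dvd y\<close> by (auto simp: parallel_class_def)
    moreover have "x mod int v \<in> {0..<int v}" using v_gt_1 by simp
    ultimately show "b \<in> (\<Union>x\<in>{0..<int v}. parallel_class x)" by blast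
  qed
qed (auto simp: blocks_def parallel_class_def)

lemma parallel_classes_disjoint:
  assumes "x \<in> {0..<int v}" "x' \<in> {0..<int v}" "b \<in> parallel_class x" "b \<in> parallel_class x'"
  shows "x = x'"
proof -
  from assms obtain y y' where b: "b = block x y" "b = block x' y'"
    by (auto simp: parallel_class_def)
  have "consecutive (block x y) (entry x y 0) (entry x y (Suc 0))"
    unfolding consecutive_block by blast
  then have "[x = x'] (mod int v)"
    using b consecutive_determines_block(1) by metis
  then show ?thesis using assms by (simp add: cong_def)
qed

lemma parallel_class_nonempty: "parallel_class x \<noteq> {}"
proof -
  have "\<not> int v dvd 1" using v_gt_1 by simp
  then show ?thesis unfolding parallel_class_def by blast
qed

lemma partitions_into_classes_blocks: "partitions_into_classes blocks v ((v - 1) div k)"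
  unfolding partitions_into_classes_def
proof (intro exI conjI ballI)
  let ?P = "parallel_class ` {0..<int v}"
  show "partition_on blocks ?P"
    unfolding partition_on_def
    using parallel_class_nonempty parallel_classes_disjoint
    by (fastforce simp: blocks_eq_parallel_classes disjoint_def)
  have "inj_on parallel_class {0..<int v}"
    using parallel_class_nonempty parallel_classes_disjoint by (intro inj_onI) blast
  then show "card ?P = v" by (simp add: card_image)
  fix P assume "P \<in> ?P"
  then obtain x where x: "x \<in> {0..<int v}" "P = parallel_class x" by blast
  show "card P = (v - 1) div k"
    using card_parallel_class[OF x(1)] k_ge_2 x(2)
    by (metis nonzero_mult_div_cancel_left not_numeral_le_zero)
  show "disjoint_family_on block_points P"
    by (simp add: x disjoint_parallel_class)
qed

lemma k_dvd_v_minus_1: "k dvd v - 1"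
  using card_parallel_class[of 0] v_gt_1 by (metis atLeastLessThan_iff dvd_triv_left of_nat_0_less_iff
      order_refl gr_implies_not_zero not_gr_zero)

theorem resolvable_mendelsohn_design_blocks:
  "resolvable_mendelsohn_design v k {0..<int v} blocks"
  unfolding resolvable_mendelsohn_design_def mendelsohn_design_def
proof (intro conjI ballI impI)
  show "k \<le> v"
    using dvd_imp_le[OF k_dvd_v_minus_1] v_gt_1 by simp
  show "blocks \<subseteq> cyclic_subsets k {0..<int v}"
  proof
    fix b assume "b \<in> blocks"
    then obtain x y where "b = block x y" "\<not> int v dvd y" by (auto simp: blocks_def)
    then show "b \<in> cyclic_subsets k {0..<int v}"
      unfolding cyclic_subsets_def block_def using inj_on_entry entry_in_range
      by (auto simp: distinct_map intro!: exI[of _ "map (entry x y) [0..<k]"])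
  qed
  fix u w assume uw: "u \<in> {0..<int v}" "w \<in> {0..<int v}" "u \<noteq> w"
  obtain b where b: "b \<in> blocks" "consecutive b u w" by (rule block_through_pair[OF uw])
  show "\<exists>!b. b \<in> blocks \<and> consecutive b u w"
  proof (intro ex1I[of _ b] conjI b)
    fix b' assume b': "b' \<in> blocks \<and> consecutive b' u w"
    obtain x y x' y' where "b = block x y" "b' = block x' y'"
      using b b' by (auto simp: blocks_def)
    then show "b' = b"
      using b b' consecutive_determines_block(2) by metis
  qed
next
  have "[v = 1] (mod k)"
    using k_dvd_v_minus_1 v_gt_1 by (simp add: cong_altdef_nat)
  then show "resolvable v k blocks"
    unfolding resolvable_def using partitions_into_classes_blocks by blast
qed (use k_ge_2 in auto)

text \<open>From one position of a block to the next, the difference of successive entries is multiplied by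
  \<open>a\<close>.  When \<open>k = 2\<close> the point \<open>z\<close> is \<open>u\<close> again.\<close>

lemma consecutive_ratio:
  assumes "b \<in> blocks" "consecutive b u w" "consecutive b w z"
  shows "[z - w = a * (w - u)] (mod int v)"
proof -
  from assms obtain x y n m where
    u: "u = entry x y n" and wn: "w = entry x y (Suc n)" and
    wm: "w = entry x y m" and z: "z = entry x y (Suc m)"
    by (auto simp: blocks_def consecutive_block)
  have "[a ^ m * y = a ^ Suc n * y] (mod int v)"
    using wn wm by (simp only: entry_eq_iff cong_add_lcancel)
  from cong_mult[OF cong_refl[of a] this]
  have "z = entry x y (Suc (Suc n))"
    unfolding z entry_eq_iff by (simp add: cong_add_lcancel mult_ac)
  then have "[z - w = x + a ^ Suc (Suc n) * y - (x + a ^ Suc n * y)] (mod int v)"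
    unfolding wn by (intro cong_diff) (simp_all add: entry_def cong_def)
  also have "x + a ^ Suc (Suc n) * y - (x + a ^ Suc n * y)
      = a * (x + a ^ Suc n * y - (x + a ^ n * y))"
    by (simp add: algebra_simps)
  also have "[a * (x + a ^ Suc n * y - (x + a ^ n * y)) = a * (w - u)] (mod int v)"
    unfolding wn u by (intro cong_mult cong_diff) (simp_all add: entry_def cong_def)
  finally show ?thesis .
qed

lemma next_point_in_block:
  assumes "b \<in> blocks" "consecutive b u w"
  obtains z where "consecutive b w z"
proof -
  from assms obtain x y n where "b = block x y" "w = entry x y (Suc n)"
    by (auto simp: blocks_def consecutive_block)
  then have "consecutive b w (entry x y (Suc (Suc n)))"
    using consecutive_block by blast
  then show thesis by (rule that)
qed

text \<open>The map \<open>g\<close> is prescribed on residues only, so that an affine map restricted to the carrier of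
  the residue ring can be used.\<close>

lemma map_affine_block:
  assumes "\<And>z. z \<in> {0..<int v} \<Longrightarrow> g z = (s + h * z) mod int v"
  shows "map g ` block x y = block (s + h * x) (h * y)"
proof -
  have "g (entry x y i) = entry (s + h * x) (h * y) i" for i
  proof -
    have "[s + h * entry x y i = s + h * (x + a ^ i * y)] (mod int v)"
      by (intro cong_add cong_mult) (simp_all add: entry_def)
    then have "g (entry x y i) = (s + h * (x + a ^ i * y)) mod int v"
      unfolding assms[OF entry_in_range] by (simp add: cong_def)
    then show ?thesis by (simp add: entry_def algebra_simps)
  qed
  then show ?thesis by (simp add: block_def map_image_cyc comp_def)
qed

lemma affine_image_blocks:
  assumes g: "\<And>z. z \<in> {0..<int v} \<Longrightarrow> g z = (s + h * z) mod int v" and h: "coprime h (int v)"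
  shows "(\<lambda>b. map g ` b) ` blocks = blocks"
proof -
  have dvd: "int v dvd h * y \<longleftrightarrow> int v dvd y" for y
    using h by (simp add: coprime_dvd_mult_right_iff coprime_commute)
  obtain l where l: "[h * l = 1] (mod int v)"
    using h cong_solve_coprime_int by blast
  have inv: "[h * (l * y) = y] (mod int v)" for y
    using cong_mult[OF l cong_refl[of y]] by (simp add: mult_ac)
  show ?thesis
  proof (intro equalityI subsetI)
    fix b assume "b \<in> (\<lambda>b. map g ` b) ` blocks"
    then obtain x y where "b = map g ` block x y" "\<not> int v dvd y"
      by (auto simp: blocks_def)
    then have "b = block (s + h * x) (h * y)" "\<not> int v dvd h * y"
      using map_affine_block[OF g] dvd by simp_all
    then show "b \<in> blocks" unfolding blocks_def by blast
  next
    fix b assume "b \<in> blocks"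
    then obtain x y where b: "b = block x y" and y: "\<not> int v dvd y" by (auto simp: blocks_def)
    have "\<not> int v dvd l * y"
      using y inv cong_dvd_iff dvd_mult by blast
    then have "block (l * (x - s)) (l * y) \<in> blocks" by (auto simp: blocks_def)
    moreover have "[s + h * (l * (x - s)) = x] (mod int v)"
      using cong_add[OF cong_refl[of s] inv[of "x - s"]] by simp
    then have "block (s + h * (l * (x - s))) (h * (l * y)) = b"
      unfolding b by (rule block_cong[OF _ inv])
    then have "b = map g ` block (l * (x - s)) (l * y)"
      using map_affine_block[OF g] by metis
    ultimately show "b \<in> (\<lambda>b. map g ` b) ` blocks" by blast
  qed
qed

end

text \<open>In both designs the block through \<open>(0, 1)\<close> continues with a point congruent to one plus the unit.\<close>

lemma blocks_determine_unit:
  assumes "semiregular_unit v k a" "semiregular_unit v k a'"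
    and eq: "semiregular_unit.blocks v k a = semiregular_unit.blocks v k a'"
  shows "[a = a'] (mod int v)"
proof -
  interpret A: semiregular_unit v k a by fact
  interpret A': semiregular_unit v k a' by fact
  obtain b where b: "b \<in> A.blocks" "consecutive b 0 1"
    using A.block_through_pair[of 0 1] A.v_gt_1 by auto
  then obtain z where z: "consecutive b 1 z"
    by (rule A.next_point_in_block)
  have "[z - 1 = a] (mod int v)" "[z - 1 = a'] (mod int v)"
    using A.consecutive_ratio[OF b z] A'.consecutive_ratio[OF _ b(2) z] b(1) eq by simp_all
  then show ?thesis by (metis cong_sym cong_trans)
qed

section \<open>The affine group of a ring and its action\<close>

lemma group_semidirect_product:
  assumes "group G" "group H"
    and hom: "\<And>h. h \<in> carrier H \<Longrightarrow> \<theta> h \<in> hom G G"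
    and mult: "\<And>h l x. h \<in> carrier H \<Longrightarrow> l \<in> carrier H \<Longrightarrow> x \<in> carrier G \<Longrightarrow>
      \<theta> (h \<otimes>\<^bsub>H\<^esub> l) x = \<theta> h (\<theta> l x)"
    and one: "\<And>x. x \<in> carrier G \<Longrightarrow> \<theta> \<one>\<^bsub>H\<^esub> x = x"
  shows "group (semidirect_product G H \<theta>)" (is "group ?S")
proof -
  interpret G: group G by fact
  interpret H: group H by fact
  have closed: "\<theta> h x \<in> carrier G" if "h \<in> carrier H" "x \<in> carrier G" for h x
    using hom that by (auto simp: hom_def)
  have add: "\<theta> h (x \<otimes>\<^bsub>G\<^esub> y) = \<theta> h x \<otimes>\<^bsub>G\<^esub> \<theta> h y"
    if "h \<in> carrier H" "x \<in> carrier G" "y \<in> carrier G" for h x y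
    using hom that by (auto simp: hom_def)
  have car: "carrier ?S = carrier G \<times> carrier H"
    and mul: "(x, h) \<otimes>\<^bsub>?S\<^esub> (y, l) = (x \<otimes>\<^bsub>G\<^esub> \<theta> h y, h \<otimes>\<^bsub>H\<^esub> l)"
    and unit: "\<one>\<^bsub>?S\<^esub> = (\<one>\<^bsub>G\<^esub>, \<one>\<^bsub>H\<^esub>)" for x h y l
    by (simp_all add: semidirect_product_def)
  show ?thesis
  proof (rule groupI)
    fix g assume "g \<in> carrier ?S"
    then obtain x h where g: "g = (x, h)" "x \<in> carrier G" "h \<in> carrier H"
      by (auto simp: car)
    let ?l = "inv\<^bsub>H\<^esub> h"
    have "(inv\<^bsub>G\<^esub> (\<theta> ?l x), ?l) \<otimes>\<^bsub>?S\<^esub> g = \<one>\<^bsub>?S\<^esub>"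
      using g closed[of ?l x] by (simp add: mul unit G.l_inv)
    moreover have "(inv\<^bsub>G\<^esub> (\<theta> ?l x), ?l) \<in> carrier ?S"
      using g closed[of ?l x] by (simp add: car)
    ultimately show "\<exists>g'\<in>carrier ?S. g' \<otimes>\<^bsub>?S\<^esub> g = \<one>\<^bsub>?S\<^esub>" by blast
    show "\<one>\<^bsub>?S\<^esub> \<otimes>\<^bsub>?S\<^esub> g = g" using g by (simp add: mul unit one)
  next
    fix f g assume "f \<in> carrier ?S" "g \<in> carrier ?S"
    then show "f \<otimes>\<^bsub>?S\<^esub> g \<in> carrier ?S" by (auto simp: car mul closed)
  next
    fix f g j assume "f \<in> carrier ?S" "g \<in> carrier ?S" "j \<in> carrier ?S"
    then obtain x h y l z m where "f = (x, h)" "g = (y, l)" "j = (z, m)"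
      and "x \<in> carrier G" "y \<in> carrier G" "z \<in> carrier G"
      and "h \<in> carrier H" "l \<in> carrier H" "m \<in> carrier H"
      by (auto simp: car)
    then show "f \<otimes>\<^bsub>?S\<^esub> g \<otimes>\<^bsub>?S\<^esub> j = f \<otimes>\<^bsub>?S\<^esub> (g \<otimes>\<^bsub>?S\<^esub> j)"
      by (simp add: mul closed add mult G.m_assoc H.m_assoc)
  qed (simp add: car unit)
qed

text \<open>The affine map \<open>z \<mapsto> x + h z\<close> is a bijection because \<open>h\<close> is a unit, and composing affine maps is
  the multiplication rule of the semidirect product, by distributivity.\<close>

lemma (in cring) affine_group_action:
  assumes H: "subgroup H (units_of R)"
  shows "group_action
    (semidirect_product (add_monoid R) ((units_of R)\<lparr>carrier := H\<rparr>) (\<lambda>h y. h \<otimes> y))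
    (carrier R) (\<lambda>(x, h). \<lambda>z\<in>carrier R. x \<oplus> h \<otimes> z)"
    (is "group_action ?A _ ?\<phi>")
proof -
  interpret U: group "units_of R" by (rule units_group)
  interpret H: subgroup H "units_of R" by (rule H)
  have unit: "h \<in> Units R" if "h \<in> H" for h
    using that H.subset by (auto simp: units_of_def)
  have in_carrier: "h \<in> carrier R" if "h \<in> H" for h
    using unit[OF that] by (rule Units_closed)
  have car: "carrier ?A = carrier R \<times> H" by (simp add: semidirect_product_def)
  have group: "group ?A"
  proof (rule group_semidirect_product)
    show "group (add_monoid R)" by (rule a_group)
    show "group ((units_of R)\<lparr>carrier := H\<rparr>)"
      by (rule H.subgroup_is_group[OF U.group_axioms])
  next
    fix h assume "h \<in> carrier ((units_of R)\<lparr>carrier := H\<rparr>)"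
    then show "(\<otimes>) h \<in> hom (add_monoid R) (add_monoid R)"
      using in_carrier[of h] by (simp add: hom_def r_distr)
  next
    fix h l x
    assume "h \<in> carrier ((units_of R)\<lparr>carrier := H\<rparr>)" "l \<in> carrier ((units_of R)\<lparr>carrier := H\<rparr>)"
      and "x \<in> carrier (add_monoid R)"
    then show "h \<otimes>\<^bsub>(units_of R)\<lparr>carrier := H\<rparr>\<^esub> l \<otimes> x = h \<otimes> (l \<otimes> x)"
      using in_carrier[of h] in_carrier[of l] by (simp add: units_of_mult m_assoc)
  next
    fix x assume "x \<in> carrier (add_monoid R)"
    then show "\<one>\<^bsub>(units_of R)\<lparr>carrier := H\<rparr>\<^esub> \<otimes> x = x"
      by (simp add: units_of_one)
  qed
  have inj: "inj_on (?\<phi> (x, h)) (carrier R)" if "x \<in> carrier R" "h \<in> H" for x h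
  proof (rule inj_onI)
    fix z z' assume "z \<in> carrier R" "z' \<in> carrier R" "?\<phi> (x, h) z = ?\<phi> (x, h) z'"
    then show "z = z'"
      using that unit[of h] in_carrier[of h] by (simp add: Units_l_cancel)
  qed
  have bij: "?\<phi> g \<in> Bij (carrier R)" if gA: "g \<in> carrier ?A" for g
  proof -
    obtain x h where g: "g = (x, h)" "x \<in> carrier R" "h \<in> H"
      using gA unfolding car by blast
    have "?\<phi> (x, h) ` carrier R = carrier R"
    proof (intro equalityI subsetI)
      fix z assume z: "z \<in> carrier R"
      let ?z' = "inv h \<otimes> (z \<ominus> x)"
      have z': "?z' \<in> carrier R" using g z unit by simp
      have "x \<oplus> h \<otimes> ?z' = x \<oplus> (z \<ominus> x)"
        using g z unit[of h] in_carrier[of h] by (simp flip: m_assoc)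
      also have "\<dots> = z" using g z by algebra
      finally have "z = ?\<phi> (x, h) ?z'" using z' by simp
      then show "z \<in> ?\<phi> (x, h) ` carrier R" using z' by (rule image_eqI)
    next
      fix z assume "z \<in> ?\<phi> (x, h) ` carrier R"
      then obtain w where "w \<in> carrier R" "z = x \<oplus> h \<otimes> w" by auto
      then show "z \<in> carrier R" using g in_carrier[of h] by simp
    qed
    then show ?thesis
      using inj[OF g(2,3)] by (simp add: Bij_def bij_betw_def g(1))
  qed
  have "?\<phi> (g \<otimes>\<^bsub>?A\<^esub> g') = compose (carrier R) (?\<phi> g) (?\<phi> g')"
    if gA: "g \<in> carrier ?A" "g' \<in> carrier ?A" for g g'
  proof -
    obtain x h y l where g: "g = (x, h)" "g' = (y, l)"
      and c: "x \<in> carrier R" "y \<in> carrier R" "h \<in> carrier R" "l \<in> carrier R"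
      using gA in_carrier unfolding car by blast
    have "g \<otimes>\<^bsub>?A\<^esub> g' = (x \<oplus> h \<otimes> y, h \<otimes> l)"
      by (simp add: g semidirect_product_def units_of_mult)
    moreover have "x \<oplus> h \<otimes> y \<oplus> h \<otimes> l \<otimes> z = x \<oplus> h \<otimes> (y \<oplus> l \<otimes> z)" if "z \<in> carrier R" for z
      using c that by (simp add: r_distr m_assoc a_assoc)
    ultimately show ?thesis
      using c by (simp add: g compose_def fun_eq_iff restrict_def)
  qed
  then have "?\<phi> \<in> hom ?A (BijGroup (carrier R))"
    using bij by (auto simp: hom_def BijGroup_def)
  then show ?thesis
    by (simp add: group_action_def group_hom_def group_hom_axioms_def group group_BijGroup)
qed

lemma group_action_compose_hom:
  assumes "group_action G E \<phi>" "group F" "f \<in> hom F G"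
  shows "group_action F E (\<lambda>g. \<phi> (f g))"
proof -
  interpret group_action G E \<phi> by fact
  interpret \<phi>: group_hom G "BijGroup E" \<phi> by (rule group_hom)
  have "\<phi> \<circ> f \<in> hom F (BijGroup E)"
    using assms(3) \<phi>.homh by (rule Group.hom_compose)
  then show ?thesis
    using assms(2) by (simp add: group_action_def group_hom_def group_hom_axioms_def comp_def
        group_BijGroup)
qed

section \<open>The design inside the residue ring\<close>

context semiregular_unit
begin

lemma residues_v: "residues (int v)"
  using v_gt_1 by unfold_locales simp

lemma carrier_Z_mod: "carrier (Z_mod v) = {0..<int v}"
  by (auto simp: residue_ring_def)

lemma unit_in_units_of: "a mod int v \<in> carrier (units_of (Z_mod v))"
proof -
  interpret residues "int v" "Z_mod v" by (rule residues_v) simp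
  have "a mod int v \<noteq> 0"
  proof
    assume "a mod int v = 0"
    then have "int v dvd a" by auto
    then have "is_unit (int v)"
      using coprime_a by (meson coprime_common_divisor dvd_refl)
    then show False using v_gt_1 by simp
  qed
  moreover have "a mod int v \<ge> 0" "a mod int v < int v" using v_gt_1 by auto
  ultimately show ?thesis
    using coprime_a by (auto simp: units_of_def res_units_eq)
qed

lemma pow_cong_1_iff: "[a ^ n = 1] (mod int v) \<longleftrightarrow> k dvd n"
proof
  assume n: "[a ^ n = 1] (mod int v)"
  have "[a ^ (k * (n div k)) * a ^ (n mod k) = 1 * a ^ (n mod k)] (mod int v)"
    using cong_pow[OF pow_k, of "n div k"] by (intro cong_mult) (simp_all add: power_mult)
  with n have *: "int v dvd a ^ (n mod k) - 1"
    by (simp add: cong_sym_eq cong_iff_dvd_diff flip: power_add)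
      (metis cong_iff_dvd_diff cong_sym cong_trans)
  show "k dvd n"
  proof (rule ccontr)
    assume "\<not> k dvd n"
    then have "coprime (a ^ (n mod k) - 1) (int v)"
      using k_ge_2 by (intro coprime_pow_minus_1) (auto simp: dvd_eq_mod_eq_0)
    with * have "is_unit (int v)" by (meson coprime_common_divisor dvd_refl)
    then show False using v_gt_1 by simp
  qed
next
  assume "k dvd n"
  then obtain m where "n = k * m" ..
  then show "[a ^ n = 1] (mod int v)"
    using cong_pow[OF pow_k, of m] by (simp add: power_mult)
qed

lemma Z_mod_pow: "(a mod int v) [^]\<^bsub>Z_mod v\<^esub> (n :: nat) = a ^ n mod int v"
proof -
  interpret residues "int v" "Z_mod v" by (rule residues_v) simp
  show ?thesis by (rule pow_cong)
qed

lemma ord_unit: "group.ord (units_of (Z_mod v)) (a mod int v) = k"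
proof -
  interpret residues "int v" "Z_mod v" by (rule residues_v) simp
  interpret U: group "units_of (Z_mod v)" by (rule units_group)
  have "(a mod int v) [^]\<^bsub>units_of (Z_mod v)\<^esub> n = \<one>\<^bsub>units_of (Z_mod v)\<^esub> \<longleftrightarrow> k dvd n" for n :: nat
  proof -
    have "(a mod int v) [^]\<^bsub>units_of (Z_mod v)\<^esub> n = a ^ n mod int v"
      using unit_in_units_of by (simp add: units_of_pow units_of_carrier Z_mod_pow)
    then show ?thesis
      using v_gt_1 by (simp add: units_of_one res_one_eq cong_def flip: pow_cong_1_iff)
  qed
  then show ?thesis
    using U.ord_unique[OF unit_in_units_of] by blast
qed

lemma entry_reduced_terms: "entry x y = (\<lambda>i. (x + a ^ i mod int v * y mod int v) mod int v)"
  by (simp add: fun_eq_iff entry_def mod_add_right_eq mod_mult_left_eq)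

lemma orbit_blocks_eq_blocks: "orbit_blocks v (a mod int v) = blocks"
proof -
  have "orbit_blocks v (a mod int v) = {block x y | x y. x \<in> {0..<int v} \<and> y \<in> {0..<int v} - {0}}"
    unfolding orbit_blocks_def ord_unit Z_mod_pow block_def carrier_Z_mod
    by (simp add: residue_ring_def entry_reduced_terms)
  also have "\<dots> = blocks"
  proof (intro equalityI subsetI)
    fix b assume "b \<in> blocks"
    then obtain x y where b: "b = block x y" "\<not> int v dvd y" by (auto simp: blocks_def)
    have "b = block (x mod int v) (y mod int v)"
      using block_cong[of x "x mod int v" y "y mod int v"] b by (simp add: cong_def)
    moreover have "x mod int v \<in> {0..<int v}" "y mod int v \<in> {0..<int v} - {0}"
      using b v_gt_1 by auto
    ultimately show "b \<in> {block x y | x y. x \<in> {0..<int v} \<and> y \<in> {0..<int v} - {0}}" by blast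
  next
    fix b assume "b \<in> {block x y | x y. x \<in> {0..<int v} \<and> y \<in> {0..<int v} - {0}}"
    then obtain x y where "b = block x y" "y \<in> {0..<int v} - {0}" by blast
    moreover from this have "\<not> int v dvd y" by (auto dest: zdvd_imp_le)
    ultimately show "b \<in> blocks" unfolding blocks_def by blast
  qed
  finally show ?thesis .
qed

lemma subgroup_generated_unit:
  "subgroup (generate (units_of (Z_mod v)) {a mod int v}) (units_of (Z_mod v))"
proof -
  interpret residues "int v" "Z_mod v" by (rule residues_v) simp
  interpret U: group "units_of (Z_mod v)" by (rule units_group)
  show ?thesis using unit_in_units_of by (intro U.generate_is_subgroup) simp
qed

lemma acts_by_affine_maps:
  "acts_by_automorphisms (affine_group v (a mod int v)) (carrier (Z_mod v)) blocks (affine_action v)"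
proof -
  interpret residues "int v" "Z_mod v" by (rule residues_v) simp
  interpret H: subgroup "generate (units_of (Z_mod v)) {a mod int v}" "units_of (Z_mod v)"
    by (rule subgroup_generated_unit)
  show ?thesis
    unfolding acts_by_automorphisms_def
  proof
    show "group_action (affine_group v (a mod int v)) (carrier (Z_mod v)) (affine_action v)"
      using affine_group_action[OF subgroup_generated_unit]
      by (simp add: affine_group_def affine_action_def)
    show "\<forall>g\<in>carrier (affine_group v (a mod int v)). (\<lambda>b. map (affine_action v g) ` b) ` blocks = blocks"
    proof
      fix g assume "g \<in> carrier (affine_group v (a mod int v))"
      then obtain s h where g: "g = (s, h)" "h \<in> generate (units_of (Z_mod v)) {a mod int v}"
        by (auto simp: affine_group_def semidirect_product_def)
      then have h: "coprime h (int v)"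
        using H.subset by (auto simp: units_of_def res_units_eq)
      show "(\<lambda>b. map (affine_action v g) ` b) ` blocks = blocks"
      proof (rule affine_image_blocks[OF _ h])
        fix z assume "z \<in> {0..<int v}"
        then show "affine_action v g z = (s + h * z) mod int v"
          by (simp add: affine_action_def g carrier_Z_mod res_add_eq res_mult_eq mod_simps)
      qed
    qed
  qed
qed

text \<open>The translations are the affine maps whose multiplier is one, so the regular representation
  is the restriction of the affine action along \<open>g \<mapsto> (g, 1)\<close>.\<close>

lemma based_on_Z_mod: "based_on (add_monoid (Z_mod v)) (carrier (Z_mod v)) blocks"
proof -
  interpret residues "int v" "Z_mod v" by (rule residues_v) simp
  interpret U: group "units_of (Z_mod v)" by (rule units_group)
  interpret H: subgroup "generate (units_of (Z_mod v)) {a mod int v}" "units_of (Z_mod v)"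
    by (rule subgroup_generated_unit)
  let ?X = "carrier (Z_mod v)"
  define i where "i = (\<lambda>g::int. (g, 1::int))"
  have one: "1 \<in> generate (units_of (Z_mod v)) {a mod int v}"
    using H.one_closed by (simp add: units_of_one res_one_eq)
  have i: "i \<in> hom (add_monoid (Z_mod v)) (affine_group v (a mod int v))"
    using one v_gt_1
    by (auto simp: hom_def i_def affine_group_def semidirect_product_def units_of_def res_mult_eq
        res_carrier_eq)
  have "acts_by_automorphisms (add_monoid (Z_mod v)) ?X blocks (\<lambda>g. affine_action v (i g))"
    unfolding acts_by_automorphisms_def
  proof
    show "group_action (add_monoid (Z_mod v)) ?X (\<lambda>g. affine_action v (i g))"
      using acts_by_affine_maps unfolding acts_by_automorphisms_def
      by (blast intro: group_action_compose_hom[OF _ a_group i])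
    show "\<forall>g\<in>carrier (add_monoid (Z_mod v)). (\<lambda>b. map (affine_action v (i g)) ` b) ` blocks = blocks"
      using acts_by_affine_maps hom_in_carrier[OF i] unfolding acts_by_automorphisms_def by blast
  qed
  also have "(\<lambda>g. affine_action v (i g)) =
      (\<lambda>g. \<lambda>x\<in>?X. id (g \<otimes>\<^bsub>add_monoid (Z_mod v)\<^esub> inv_into (carrier (add_monoid (Z_mod v))) id x))"
    using inv_into_f_f[OF inj_on_id, of _ ?X]
    by (auto simp: fun_eq_iff affine_action_def i_def res_add_eq res_mult_eq restrict_def mod_simps)
  finally have "acts_by_automorphisms (add_monoid (Z_mod v)) ?X blocks
      (\<lambda>g. \<lambda>x\<in>?X. id (g \<otimes>\<^bsub>add_monoid (Z_mod v)\<^esub> inv_into (carrier (add_monoid (Z_mod v))) id x))" .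
  moreover have "bij_betw id (carrier (add_monoid (Z_mod v))) ?X" by simp
  ultimately show ?thesis unfolding based_on_def by blast
qed

end

section \<open>Elements of order k modulo a prime power\<close>

text \<open>In \<open>x ^ k - 1 = (x - 1) * (1 + x + \<dots> + x ^ (k - 1))\<close> the second factor is congruent to \<open>k\<close>
  modulo \<open>p\<close>, hence coprime to \<open>p\<close>, so all of \<open>p ^ e\<close> divides \<open>x - 1\<close>.\<close>

lemma cong_1_mod_power:
  fixes x p :: int
  assumes x: "[x = 1] (mod p)" and pow: "[x ^ k = 1] (mod p ^ e)" and k: "coprime (int k) p"
  shows "[x = 1] (mod p ^ e)"
proof -
  let ?s = "\<Sum>i<k. x ^ i"
  have "[?s = (\<Sum>i<k. 1)] (mod p)"
    by (rule cong_sum) (use cong_pow[OF x] in auto)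
  then have "[int k = ?s] (mod p)" by (simp add: cong_sym_eq)
  then have "coprime ?s p" by (rule cong_imp_coprime) (rule k)
  then have "coprime (p ^ e) ?s" by (simp add: coprime_commute)
  moreover have "p ^ e dvd (x - 1) * ?s"
    using pow by (simp add: cong_iff_dvd_diff power_diff_1_eq)
  ultimately show ?thesis
    by (simp add: coprime_dvd_mult_left_iff cong_iff_dvd_diff)
qed

text \<open>For a primitive root \<open>\<eta>\<close> modulo \<open>n\<close> and \<open>k\<close> dividing \<open>\<phi>(n)\<close>, these are the elements of order
  \<open>k\<close> when \<open>m\<close> runs over the integers coprime to \<open>k\<close>.\<close>

definition root_power :: "nat \<Rightarrow> nat \<Rightarrow> nat \<Rightarrow> nat \<Rightarrow> int" where
  "root_power n \<eta> k m = int \<eta> ^ (m * totient n div k)"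

context
  fixes p e \<eta> k :: nat
  assumes p: "prime p" and e: "e \<ge> 1" and \<eta>: "residue_primroot (p ^ e) \<eta>"
    and k: "k dvd p - 1"
begin

lemma k_pos: "0 < k"
  using k prime_gt_1_nat[OF p] by (intro Nat.gr0I) auto

lemma totient_factor:
  obtains d where "totient (p ^ e) = k * d" "0 < d"
proof -
  have "k dvd totient (p ^ e)"
    using e k p by (simp add: totient_prime_power)
  then obtain d where d: "totient (p ^ e) = k * d" ..
  have "0 < totient (p ^ e)" using p by (simp add: prime_gt_0_nat)
  then have "0 < d" unfolding d by simp
  with d show thesis by (rule that)
qed

lemma root_power_cong_iff:
  assumes "m \<in> totatives k" "m' \<in> totatives k" "2 \<le> k"
  shows "[root_power (p ^ e) \<eta> k m = root_power (p ^ e) \<eta> k m'] (mod int (p ^ e)) \<longleftrightarrow> m = m'"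
proof
  obtain d where d: "totient (p ^ e) = k * d" "0 < d" by (rule totient_factor)
  have \<eta>': "coprime (p ^ e) \<eta>" "ord (p ^ e) \<eta> = k * d"
    using \<eta> d by (auto elim: residue_primroot.cases)
  have [simp]: "n * (k * d) div k = n * d" for n
    using k_pos by (simp add: mult.left_commute)
  assume "[root_power (p ^ e) \<eta> k m = root_power (p ^ e) \<eta> k m'] (mod int (p ^ e))"
  then have "[int (\<eta> ^ (m * d)) = int (\<eta> ^ (m' * d))] (mod int (p ^ e))"
    by (simp add: root_power_def d)
  then have "[\<eta> ^ (m * d) = \<eta> ^ (m' * d)] (mod p ^ e)"
    by (simp only: cong_int_iff)
  then have "[m * d = m' * d] (mod k * d)"
    using order_divides_expdiff[OF \<eta>'(1)] \<eta>'(2) by simp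
  then have "m mod k = m' mod k"
    using d by (simp add: cong_def)
  then show "m = m'"
    using assms totatives_less by (metis mod_less Suc_1 Suc_le_lessD)
qed simp

lemma root_power_pow_cong_1_iff:
  assumes "coprime m k"
  shows "[root_power (p ^ e) \<eta> k m ^ n = 1] (mod int (p ^ e)) \<longleftrightarrow> k dvd n"
proof -
  obtain d where d: "totient (p ^ e) = k * d" "0 < d" by (rule totient_factor)
  have ord: "ord (p ^ e) \<eta> = k * d"
    using \<eta> d by (auto elim: residue_primroot.cases)
  have "m * totient (p ^ e) div k = m * d"
    using k_pos d by (simp add: mult.left_commute)
  then have "root_power (p ^ e) \<eta> k m ^ n = int (\<eta> ^ (m * n * d))"
    by (simp add: root_power_def mult_ac flip: power_mult)
  then have "[root_power (p ^ e) \<eta> k m ^ n = 1] (mod int (p ^ e)) \<longleftrightarrow> [int (\<eta> ^ (m * n * d)) = int 1] (mod int (p ^ e))"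
    by simp
  also have "\<dots> \<longleftrightarrow> k * d dvd m * n * d"
    unfolding cong_int_iff ord_divides ord ..
  also have "\<dots> \<longleftrightarrow> k dvd n"
    using d assms by (simp add: coprime_dvd_mult_right_iff coprime_commute)
  finally show ?thesis .
qed

text \<open>Let \<open>g\<close> be the root power.  If \<open>p\<close> divided \<open>g ^ i - 1\<close>, then \<open>g ^ i\<close>, whose \<open>k\<close>-th power is one, would be congruent to one
  modulo \<open>p ^ e\<close> by \<open>cong_1_mod_power\<close>, against the order of \<open>g\<close>.\<close>

lemma coprime_root_power_pow_minus_1:
  assumes "coprime m k" "0 < i" "i < k"
  shows "coprime (root_power (p ^ e) \<eta> k m ^ i - 1) (int (p ^ e))"
proof (rule ccontr)
  assume "\<not> coprime (root_power (p ^ e) \<eta> k m ^ i - 1) (int (p ^ e))"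
  then have "\<not> coprime (int p) (root_power (p ^ e) \<eta> k m ^ i - 1)"
    by (auto simp: coprime_commute)
  then have "[root_power (p ^ e) \<eta> k m ^ i = 1] (mod int p)"
    using p prime_imp_coprime[of "int p"] by (auto simp: cong_iff_dvd_diff)
  moreover have "[(root_power (p ^ e) \<eta> k m ^ i) ^ k = 1] (mod int p ^ e)"
    using root_power_pow_cong_1_iff[OF assms(1), of "i * k"] by (simp add: power_mult)
  moreover have "k < p" using dvd_imp_le[OF k] prime_gt_1_nat[OF p] by simp
  then have "\<not> p dvd k" using k_pos by (auto dest: dvd_imp_le)
  then have "coprime (int k) (int p)"
    using p prime_imp_coprime[of p k] by (simp add: coprime_commute)
  ultimately have "[root_power (p ^ e) \<eta> k m ^ i = 1] (mod int p ^ e)" by (rule cong_1_mod_power)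
  then have "k dvd i" using root_power_pow_cong_1_iff[OF assms(1)] by simp
  then show False using assms by (auto dest: dvd_imp_le)
qed

end

section \<open>Combining the prime powers\<close>

text \<open>Modulo \<open>q j\<close> every summand but the one of index \<open>j\<close> vanishes, since \<open>q j\<close> divides \<open>v div q i\<close>
  for \<open>i \<noteq> j\<close>.\<close>

lemma chinese_remainder_sum:
  fixes q :: "'i \<Rightarrow> nat" and c b :: "'i \<Rightarrow> int"
  assumes "finite I" "j \<in> I" and pos: "\<And>i. i \<in> I \<Longrightarrow> 0 < q i"
    and v: "v = (\<Prod>i\<in>I. q i)"
    and b: "[int (v div q j) * b j = 1] (mod int (q j))"
  shows "[(\<Sum>i\<in>I. int (v div q i) * c i * b i) = c j] (mod int (q j))"
proof -
  have "int (q j) dvd int (v div q i)" if "i \<in> I - {j}" for i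
  proof -
    have "v = q i * (\<Prod>l\<in>I - {i}. q l)"
      using that \<open>finite I\<close> by (simp add: v prod.remove[of I i])
    then have "v div q i = (\<Prod>l\<in>I - {i}. q l)" using that pos by simp
    moreover have "q j dvd (\<Prod>l\<in>I - {i}. q l)"
      using that \<open>finite I\<close> \<open>j \<in> I\<close> by (intro dvd_prodI) auto
    ultimately show ?thesis by (simp only: of_nat_dvd_iff)
  qed
  then have "int (q j) dvd (\<Sum>i\<in>I - {j}. int (v div q i) * c i * b i)"
    by (intro dvd_sum) simp
  then have "[(\<Sum>i\<in>I - {j}. int (v div q i) * c i * b i) = 0] (mod int (q j))"
    by (simp add: cong_0_iff)
  moreover have "[int (v div q j) * c j * b j = c j] (mod int (q j))"
    using cong_mult[OF b cong_refl[of "c j"]] by (simp add: mult_ac)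
  ultimately show ?thesis
    using cong_add[of "int (v div q j) * c j * b j" "c j" "int (q j)"
        "\<Sum>i\<in>I - {j}. int (v div q i) * c i * b i" 0] assms(1,2)
    by (simp add: sum.remove[of I j])
qed

theorem theorem4p1:
  fixes v t k :: nat and p e \<eta> :: "nat \<Rightarrow> nat" and b :: "nat \<Rightarrow> int"
  assumes v_odd: "odd v" and v_ge: "v \<ge> 3"
    and v_fact: "v = (\<Prod>i\<in>{1..t}. p i ^ e i)"
    and p_prime: "\<And>i. i \<in> {1..t} \<Longrightarrow> prime (p i)"
    and p_inj: "inj_on p {1..t}"
    and e_pos: "\<And>i. i \<in> {1..t} \<Longrightarrow> e i \<ge> 1"
    and primroot: "\<And>i. i \<in> {1..t} \<Longrightarrow> residue_primroot (p i ^ e i) (\<eta> i)"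
    and b_inv: "\<And>i. i \<in> {1..t} \<Longrightarrow> [int (v div p i ^ e i) * b i = 1] (mod int (p i ^ e i))"
    and k_even: "even k"
    and k_dvd: "k dvd (GCD i\<in>{1..t}. p i - 1)"
  shows "\<exists>\<D>. finite \<D> \<and> card \<D> \<ge> totient k ^ t \<and>
     (\<forall>\<B>\<in>\<D>.
        resolvable_mendelsohn_design v k (carrier (Z_mod v)) \<B> \<and>
        based_on (add_monoid (Z_mod v)) (carrier (Z_mod v)) \<B> \<and>
        (\<exists>(a :: int) (as :: nat \<Rightarrow> int) (m :: nat \<Rightarrow> nat).
           (\<forall>i\<in>{1..t}. coprime (m i) k \<and>
              [as i = int (\<eta> i) ^ (m i * totient (p i ^ e i) div k)] (mod int (p i ^ e i))) \<and>
           a = (\<Sum>i\<in>{1..t}. int (v div p i ^ e i) * as i * b i) \<and>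
           a mod int v \<in> carrier (units_of (Z_mod v)) \<and>
           group.ord (units_of (Z_mod v)) (a mod int v) = k \<and>
           \<B> = orbit_blocks v (a mod int v) \<and>
           acts_by_automorphisms (affine_group v (a mod int v)) (carrier (Z_mod v)) \<B>
             (affine_action v)))"
proof -
  define q where "q i = p i ^ e i" for i
  define as where "as m i = root_power (q i) (\<eta> i) k (m i)" for m :: "nat \<Rightarrow> nat" and i
  define a where "a m = (\<Sum>i\<in>{1..t}. int (v div q i) * as m i * b i)" for m
  \<comment> \<open>Totatives of \<open>k\<close> represent the exponents coprime to \<open>k\<close> without repetition.\<close>
  define M where "M = {1..t} \<rightarrow>\<^sub>E totatives k"
  have k_dvd_p: "k dvd p i - 1" if "i \<in> {1..t}" for i
    using k_dvd that by (meson Gcd_dvd dvd_trans image_eqI)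
  have one: "1 \<in> {1..t}"
    using v_ge v_fact by (cases t) auto
  have "0 < k"
    by (rule k_pos[OF p_prime[OF one] e_pos[OF one] primroot[OF one] k_dvd_p[OF one]])
  with k_even have k2: "2 \<le> k" by (auto elim!: evenE)
  have a_cong: "[a m = as m j] (mod int (q j))" if "j \<in> {1..t}" for m j
    unfolding a_def
  proof (rule chinese_remainder_sum)
    show "0 < q i" if "i \<in> {1..t}" for i
      using p_prime[OF that] by (simp add: q_def prime_gt_0_nat)
    show "[int (v div q j) * b j = 1] (mod int (q j))"
      using b_inv[OF that] by (simp add: q_def)
  qed (use that v_fact in \<open>simp_all add: q_def\<close>)
  have coprime_q: "coprime (q i) (q j)" if "i \<in> {1..t}" "j \<in> {1..t}" "i \<noteq> j" for i j
  proof -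
    have "p i \<noteq> p j" using inj_onD[OF p_inj] that by blast
    then have "coprime (p i) (p j)"
      using primes_coprime_nat p_prime that by blast
    then show ?thesis by (simp add: q_def)
  qed
  have v_prod: "int v = (\<Prod>i\<in>{1..t}. int (q i))" by (simp add: v_fact q_def)
  have unit: "semiregular_unit v k (a m)" if m: "m \<in> M" for m
  proof
    have mi: "coprime (m i) k" if "i \<in> {1..t}" for i
      using m that by (auto simp: M_def in_totatives_iff)
    show "1 < v" using v_ge by simp
    show "2 \<le> k" by (rule k2)
    show "[a m ^ k = 1] (mod int v)"
      unfolding v_prod
    proof (rule cong_cong_prod_coprime)
      show "\<forall>i\<in>{1..t}. [a m ^ k = 1] (mod int (q i))"
      proof
        fix i assume i: "i \<in> {1..t}"
        have "[as m i ^ k = 1] (mod int (q i))"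
          unfolding as_def q_def
          using root_power_pow_cong_1_iff[OF p_prime[OF i] e_pos[OF i] primroot[OF i] k_dvd_p[OF i] mi[OF i]]
          by simp
        then show "[a m ^ k = 1] (mod int (q i))"
          using cong_pow[OF a_cong[OF i]] cong_trans by blast
      qed
    qed (use coprime_q in auto)
    fix n assume n: "0 < n" "n < k"
    show "coprime (a m ^ n - 1) (int v)"
      unfolding v_prod
    proof (rule prod_coprime_right)
      fix i assume i: "i \<in> {1..t}"
      have "coprime (as m i ^ n - 1) (int (q i))"
        unfolding as_def q_def
        by (rule coprime_root_power_pow_minus_1[OF p_prime[OF i] e_pos[OF i] primroot[OF i]
              k_dvd_p[OF i] mi[OF i] n])
      moreover have "[as m i ^ n - 1 = a m ^ n - 1] (mod int (q i))"
        by (intro cong_diff cong_pow cong_sym[OF a_cong[OF i]] cong_refl)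
      ultimately show "coprime (a m ^ n - 1) (int (q i))"
        using cong_imp_coprime by blast
    qed
  qed
  define \<D> where "\<D> = (\<lambda>m. semiregular_unit.blocks v k (a m)) ` M"
  have "inj_on (\<lambda>m. semiregular_unit.blocks v k (a m)) M"
  proof (rule inj_onI)
    fix m m'
    assume m: "m \<in> M" "m' \<in> M"
      and "semiregular_unit.blocks v k (a m) = semiregular_unit.blocks v k (a m')"
    then have a: "[a m = a m'] (mod int v)"
      by (intro blocks_determine_unit[OF unit unit])
    have "m i = m' i" if i: "i \<in> {1..t}" for i
    proof -
      have "int (q i) dvd int v"
        unfolding v_prod using i by (intro dvd_prodI) auto
      with a have "[a m = a m'] (mod int (q i))" by (rule cong_dvd_modulus)
      then have "[as m i = as m' i] (mod int (q i))"
        using a_cong[OF i] by (meson cong_sym cong_trans)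
      then show ?thesis
        unfolding as_def q_def
        using root_power_cong_iff[OF p_prime[OF i] e_pos[OF i] primroot[OF i] k_dvd_p[OF i]
            PiE_mem[OF m(1)[unfolded M_def] i] PiE_mem[OF m(2)[unfolded M_def] i] k2]
        by blast
    qed
    then show "m = m'"
      using m unfolding M_def by (intro PiE_ext)
  qed
  then have card: "card \<D> = totient k ^ t"
    by (simp add: \<D>_def card_image M_def card_funcsetE totient_def)
  have design: "resolvable_mendelsohn_design v k (carrier (Z_mod v)) \<B> \<and>
        based_on (add_monoid (Z_mod v)) (carrier (Z_mod v)) \<B> \<and>
        (\<exists>(a :: int) (as :: nat \<Rightarrow> int) (m :: nat \<Rightarrow> nat).
           (\<forall>i\<in>{1..t}. coprime (m i) k \<and>
              [as i = int (\<eta> i) ^ (m i * totient (p i ^ e i) div k)] (mod int (p i ^ e i))) \<and>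
           a = (\<Sum>i\<in>{1..t}. int (v div p i ^ e i) * as i * b i) \<and>
           a mod int v \<in> carrier (units_of (Z_mod v)) \<and>
           group.ord (units_of (Z_mod v)) (a mod int v) = k \<and>
           \<B> = orbit_blocks v (a mod int v) \<and>
           acts_by_automorphisms (affine_group v (a mod int v)) (carrier (Z_mod v)) \<B>
             (affine_action v))" if \<B>_in: "\<B> \<in> \<D>" for \<B>
  proof -
    obtain m where m: "m \<in> M" and \<B>: "\<B> = semiregular_unit.blocks v k (a m)"
      using \<B>_in unfolding \<D>_def by blast
    interpret semiregular_unit v k "a m" by (rule unit[OF m])
    show ?thesis
      unfolding \<B>
    proof (intro conjI exI[of _ "a m"] exI[of _ "as m"] exI[of _ m])
      show "resolvable_mendelsohn_design v k (carrier (Z_mod v)) blocks"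
        unfolding carrier_Z_mod by (rule resolvable_mendelsohn_design_blocks)
      show "\<forall>i\<in>{1..t}. coprime (m i) k \<and>
          [as m i = int (\<eta> i) ^ (m i * totient (p i ^ e i) div k)] (mod int (p i ^ e i))"
        using m by (auto simp: M_def in_totatives_iff as_def q_def root_power_def)
      show "a m = (\<Sum>i\<in>{1..t}. int (v div p i ^ e i) * as m i * b i)"
        by (simp add: a_def q_def)
    qed (rule based_on_Z_mod unit_in_units_of ord_unit orbit_blocks_eq_blocks[symmetric]
        acts_by_affine_maps)+
  qed
  show ?thesis
  proof (intro exI[of _ \<D>] conjI)
    show "finite \<D>" by (simp add: \<D>_def M_def finite_PiE)
    show "totient k ^ t \<le> card \<D>" by (simp add: card)
  qed (rule ballI, erule design)
qed

end
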